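(* There exist a Boolean algebra $B$ and two different ultracontacts $\mathscr K_1\neq\mathscr K_2$ on $B$ such that $\mathrel{C_{\mathscr K_1}}=\mathrel{C_{\mathscr K_2}}$, where for an ultracontact $\mathscr K$ the relation $\mathrel{C_{\mathscr K}}$ is defined by $x\mathrel{C_{\mathscr K}}y$ iff $\{x,y\}\in\mathscr K$.
   Context: Let $B$ be a non-trivial Boolean algebra with order $\le$ and join $+$. For $F,G\subseteq B$ put $F+G=\{f+g: f\in F,\ g\in G\}$, and write $F\preceq G$ iff for every $g\in G$ there is $f\in F$ with $f\le g$. An ultracontact on $B$ is a family $\mathscr K\subseteq 2^B$ such that for all $F,G\subseteq B$: (K0) $\emptyset\notin\mathscr K$; (K1) if $0\in F$ then $F\notin\mathscr K$; (K2) if $x\neq 0$ then $\{x\}\in\mathscr K$; (K3) if $F\preceq G$, $G\neq\emptyset$ and $F\in\mathscr K$, then $G\in\mathscr K$; (K4) if $F+G\in\mathscr K$ then $F\in\mathscr K$ or $G\in\mathscr K$. *)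

theory Defs
  imports "HOL-Algebra.Lattice"
begin

locale nontrivial_boolean_algebra = bounded_lattice B for B (structure) +
  assumes meet_join_distrib:
      "\<lbrakk>x \<in> carrier B; y \<in> carrier B; z \<in> carrier B\<rbrakk> \<Longrightarrow>
        x \<sqinter> (y \<squnion> z) = (x \<sqinter> y) \<squnion> (x \<sqinter> z)"
    and complement_exists:
      "x \<in> carrier B \<Longrightarrow> \<exists>y \<in> carrier B. x \<sqinter> y = \<bottom> \<and> x \<squnion> y = \<top>"
    and nontrivial: "\<bottom> \<noteq> \<top>"

definition join_sets :: "('a, 'b) gorder_scheme \<Rightarrow> 'a set \<Rightarrow> 'a set \<Rightarrow> 'a set" where
  "join_sets B F G = {f \<squnion>\<^bsub>B\<^esub> g | f g. f \<in> F \<and> g \<in> G}"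

definition refines :: "('a, 'b) gorder_scheme \<Rightarrow> 'a set \<Rightarrow> 'a set \<Rightarrow> bool" where
  "refines B F G \<longleftrightarrow> (\<forall>g \<in> G. \<exists>f \<in> F. f \<sqsubseteq>\<^bsub>B\<^esub> g)"

locale ultracontact = nontrivial_boolean_algebra B for B (structure) +
  fixes K :: "'a set set"
  assumes families: "K \<subseteq> Pow (carrier B)"
    and K0: "{} \<notin> K"
    and K1: "\<lbrakk>F \<subseteq> carrier B; \<bottom> \<in> F\<rbrakk> \<Longrightarrow> F \<notin> K"
    and K2: "\<lbrakk>x \<in> carrier B; x \<noteq> \<bottom>\<rbrakk> \<Longrightarrow> {x} \<in> K"
    and K3: "\<lbrakk>F \<subseteq> carrier B; G \<subseteq> carrier B; refines B F G; G \<noteq> {}; F \<in> K\<rbrakk> \<Longrightarrow> G \<in> K"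
    and K4: "\<lbrakk>F \<subseteq> carrier B; G \<subseteq> carrier B; join_sets B F G \<in> K\<rbrakk> \<Longrightarrow> F \<in> K \<or> G \<in> K"

definition contact_rel :: "('a, 'b) gorder_scheme \<Rightarrow> 'a set set \<Rightarrow> ('a \<times> 'a) set" where
  "contact_rel B K = {(x, y). x \<in> carrier B \<and> y \<in> carrier B \<and> {x, y} \<in> K}"

end

theory Submission
  imports Defs
begin

text \<open>
  For a cover \<open>\<S>\<close> of a set \<open>A\<close>, the nonempty families of subsets of \<open>A\<close> all of whose members
  meet one common set from \<open>\<S>\<close> form an ultracontact on the powerset algebra of \<open>A\<close>: if \<open>F\<close> and
  \<open>G\<close> are not of this kind, then for each \<open>S\<close> from \<open>\<S>\<close> there are a member of \<open>F\<close> and a member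
  of \<open>G\<close> missing \<open>S\<close>, and so does their union. The cover by the sets of at most two points and
  the cover \<open>{A}\<close> both put any two nonempty sets in contact, but only the second one admits a
  family of three disjoint sets.
\<close>

definition powerset_algebra :: "'a set \<Rightarrow> 'a set gorder" where
  "powerset_algebra A = \<lparr>carrier = Pow A, eq = (=), le = (\<subseteq>)\<rparr>"

lemma powerset_algebra_simps [simp]:
  "carrier (powerset_algebra A) = Pow A"
  "x .=\<^bsub>powerset_algebra A\<^esub> y \<longleftrightarrow> x = y"
  "x \<sqsubseteq>\<^bsub>powerset_algebra A\<^esub> y \<longleftrightarrow> x \<subseteq> y"
  by (simp_all add: powerset_algebra_def)

text \<open>The equivalence serves twice: from right to left it gives the suprema that the lattice
  axioms demand, and from left to right it pins down the value that \<open>SOME\<close> picks in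
  \<open>sup\<close>. The three lemmas that follow have this form for the same reason.\<close>

lemma least_Upper_powerset_algebra_iff:
  assumes "x \<subseteq> A" "y \<subseteq> A"
  shows "least (powerset_algebra A) s (Upper (powerset_algebra A) {x, y}) \<longleftrightarrow> s = x \<union> y"
proof -
  have "Upper (powerset_algebra A) {x, y} = {u. u \<subseteq> A \<and> x \<union> y \<subseteq> u}"
    using assms by (auto simp: Upper_def)
  then show ?thesis
    using assms by (auto simp: least_def)
qed

lemma greatest_Lower_powerset_algebra_iff:
  assumes "x \<subseteq> A" "y \<subseteq> A"
  shows "greatest (powerset_algebra A) s (Lower (powerset_algebra A) {x, y}) \<longleftrightarrow> s = x \<inter> y"
proof -
  have "Lower (powerset_algebra A) {x, y} = {l. l \<subseteq> x \<inter> y}"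
    using assms by (auto simp: Lower_def)
  then show ?thesis
    using assms by (auto simp: greatest_def)
qed

lemma least_powerset_algebra_iff:
  "least (powerset_algebra A) s (Pow A) \<longleftrightarrow> s = {}"
  unfolding least_def by auto

lemma greatest_powerset_algebra_iff:
  "greatest (powerset_algebra A) s (Pow A) \<longleftrightarrow> s = A"
  unfolding greatest_def by auto

lemma join_powerset_algebra:
  "x \<subseteq> A \<Longrightarrow> y \<subseteq> A \<Longrightarrow> x \<squnion>\<^bsub>powerset_algebra A\<^esub> y = x \<union> y"
  by (simp add: join_def sup_def least_Upper_powerset_algebra_iff)

lemma meet_powerset_algebra:
  "x \<subseteq> A \<Longrightarrow> y \<subseteq> A \<Longrightarrow> x \<sqinter>\<^bsub>powerset_algebra A\<^esub> y = x \<inter> y"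
  by (simp add: meet_def inf_def greatest_Lower_powerset_algebra_iff)

lemma bottom_powerset_algebra: "\<bottom>\<^bsub>powerset_algebra A\<^esub> = {}"
  by (simp add: bottom_def least_powerset_algebra_iff)

lemma top_powerset_algebra: "\<top>\<^bsub>powerset_algebra A\<^esub> = A"
  by (simp add: top_def greatest_powerset_algebra_iff)

lemma nontrivial_boolean_algebra_powerset_algebra:
  assumes "A \<noteq> {}"
  shows "nontrivial_boolean_algebra (powerset_algebra A)" (is "nontrivial_boolean_algebra ?B")
proof -
  interpret partial_order ?B
    \<comment> \<open>Extensionality is for the axiom of \<open>partial_order\<close> that equates
      the relation \<open>.=\<close> with \<open>=\<close>.\<close>
    by standard (auto simp: fun_eq_iff)
  show ?thesis
  proof
    show "\<exists>s. least ?B s (Upper ?B {x, y})" if "x \<in> carrier ?B" "y \<in> carrier ?B" for x y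
      using that by (simp add: least_Upper_powerset_algebra_iff)
    show "\<exists>s. greatest ?B s (Lower ?B {x, y})" if "x \<in> carrier ?B" "y \<in> carrier ?B" for x y
      using that by (simp add: greatest_Lower_powerset_algebra_iff)
    show "\<exists>x. least ?B x (carrier ?B)"
      by (simp add: least_powerset_algebra_iff)
    show "\<exists>x. greatest ?B x (carrier ?B)"
      by (simp add: greatest_powerset_algebra_iff)
    show "x \<sqinter>\<^bsub>?B\<^esub> (y \<squnion>\<^bsub>?B\<^esub> z) = (x \<sqinter>\<^bsub>?B\<^esub> y) \<squnion>\<^bsub>?B\<^esub> (x \<sqinter>\<^bsub>?B\<^esub> z)"
      if "x \<in> carrier ?B" "y \<in> carrier ?B" "z \<in> carrier ?B" for x y z
      using that
      by (simp add: join_powerset_algebra meet_powerset_algebra le_infI1 Int_Un_distrib)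
    show "\<exists>y\<in>carrier ?B. x \<sqinter>\<^bsub>?B\<^esub> y = \<bottom>\<^bsub>?B\<^esub> \<and> x \<squnion>\<^bsub>?B\<^esub> y = \<top>\<^bsub>?B\<^esub>"
      if "x \<in> carrier ?B" for x
      using that
      by (intro bexI[of _ "A - x"])
        (auto simp: join_powerset_algebra meet_powerset_algebra bottom_powerset_algebra
          top_powerset_algebra)
    show "\<bottom>\<^bsub>?B\<^esub> \<noteq> \<top>\<^bsub>?B\<^esub>"
      using assms by (simp add: bottom_powerset_algebra top_powerset_algebra)
  qed
qed

text \<open>Nonemptiness of \<open>F\<close> is a separate condition because the empty family meets
  any \<open>S\<close> vacuously, which would violate K0.\<close>

definition meeting_families :: "'a set \<Rightarrow> 'a set set \<Rightarrow> 'a set set set" where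
  "meeting_families A \<S> = {F. F \<subseteq> Pow A \<and> F \<noteq> {} \<and> (\<exists>S\<in>\<S>. \<forall>f\<in>F. f \<inter> S \<noteq> {})}"

lemma meeting_familiesI:
  "F \<subseteq> Pow A \<Longrightarrow> F \<noteq> {} \<Longrightarrow> S \<in> \<S> \<Longrightarrow> (\<And>f. f \<in> F \<Longrightarrow> f \<inter> S \<noteq> {}) \<Longrightarrow> F \<in> meeting_families A \<S>"
  unfolding meeting_families_def by blast

lemma join_sets_powerset_algebra:
  assumes "F \<subseteq> Pow A" "G \<subseteq> Pow A"
  shows "join_sets (powerset_algebra A) F G = {f \<union> g | f g. f \<in> F \<and> g \<in> G}"
proof -
  have "f \<squnion>\<^bsub>powerset_algebra A\<^esub> g = f \<union> g" if "f \<in> F" "g \<in> G" for f g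
    using that assms by (intro join_powerset_algebra) auto
  then show ?thesis
    unfolding join_sets_def by (intro Collect_cong ex_cong1) auto
qed

lemma ultracontact_meeting_families:
  assumes "A \<noteq> {}" and cover: "A \<subseteq> \<Union>\<S>"
  shows "ultracontact (powerset_algebra A) (meeting_families A \<S>)"
proof (rule ultracontact.intro)
  show "nontrivial_boolean_algebra (powerset_algebra A)"
    by (rule nontrivial_boolean_algebra_powerset_algebra) fact
  show "ultracontact_axioms (powerset_algebra A) (meeting_families A \<S>)"
  proof
    show "{x} \<in> meeting_families A \<S>"
      if "x \<in> carrier (powerset_algebra A)" "x \<noteq> \<bottom>\<^bsub>powerset_algebra A\<^esub>" for x
      \<comment> \<open>A point of \<open>x\<close> lies in some member of the cover, and that
        member is the witness.\<close>
      using that cover by (fastforce simp: meeting_families_def bottom_powerset_algebra)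
    show "G \<in> meeting_families A \<S>"
      if "G \<subseteq> carrier (powerset_algebra A)" "refines (powerset_algebra A) F G" "G \<noteq> {}"
        "F \<in> meeting_families A \<S>" for F G
    proof -
      from that(4) obtain S where "S \<in> \<S>" and S: "\<And>f. f \<in> F \<Longrightarrow> f \<inter> S \<noteq> {}"
        unfolding meeting_families_def by blast
      \<comment> \<open>The witness for \<open>F\<close> also works for \<open>G\<close>, since a
        superset of a set meeting \<open>S\<close> meets \<open>S\<close>.\<close>
      have "g \<inter> S \<noteq> {}" if "g \<in> G" for g
      proof -
        from that \<open>refines _ F G\<close> obtain f where "f \<in> F" "f \<subseteq> g"
          by (auto simp: refines_def)
        then show ?thesis
          using S by blast
      qed
      then show ?thesis
        using that(1,3) \<open>S \<in> \<S>\<close> by (simp add: meeting_familiesI)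
    qed
    show "F \<in> meeting_families A \<S> \<or> G \<in> meeting_families A \<S>"
      if sub: "F \<subseteq> carrier (powerset_algebra A)" "G \<subseteq> carrier (powerset_algebra A)"
        and FG: "join_sets (powerset_algebra A) F G \<in> meeting_families A \<S>" for F G
    proof -
      let ?FG = "join_sets (powerset_algebra A) F G"
      have eq: "?FG = {f \<union> g | f g. f \<in> F \<and> g \<in> G}"
        using sub by (simp add: join_sets_powerset_algebra)
      from FG obtain S where "?FG \<noteq> {}" "S \<in> \<S>" and S: "\<And>h. h \<in> ?FG \<Longrightarrow> h \<inter> S \<noteq> {}"
        unfolding meeting_families_def by blast
      have "f \<inter> S \<noteq> {} \<or> g \<inter> S \<noteq> {}" if "f \<in> F" "g \<in> G" for f g
        using S[of "f \<union> g"] that by (auto simp: eq)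
      \<comment> \<open>Since \<open>S\<close> does not depend on the pair, a single
        \<open>f\<close> missing \<open>S\<close> forces every \<open>g\<close> to meet it.\<close>
      then consider "\<forall>f\<in>F. f \<inter> S \<noteq> {}" | "\<forall>g\<in>G. g \<inter> S \<noteq> {}"
        by metis
      then show ?thesis
      proof cases
        case 1
        then have "\<exists>S\<in>\<S>. \<forall>f\<in>F. f \<inter> S \<noteq> {}"
          using \<open>S \<in> \<S>\<close> by (rule bexI)
        moreover from \<open>?FG \<noteq> {}\<close> have "F \<noteq> {}"
          by (auto simp: eq)
        ultimately have "F \<in> meeting_families A \<S>"
          using sub(1) by (simp add: meeting_families_def)
        then show ?thesis ..
      next
        case 2
        then have "\<exists>S\<in>\<S>. \<forall>f\<in>G. f \<inter> S \<noteq> {}"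
          using \<open>S \<in> \<S>\<close> by (rule bexI)
        moreover from \<open>?FG \<noteq> {}\<close> have "G \<noteq> {}"
          by (auto simp: eq)
        ultimately have "G \<in> meeting_families A \<S>"
          using sub(2) by (simp add: meeting_families_def)
        then show ?thesis ..
      qed
    qed
  \<comment> \<open>This leaves K0, K1 and the inclusion in the powerset of the carrier; K1 holds
    because the bottom element is the empty set, which misses every \<open>S\<close>.\<close>
  qed (auto simp: meeting_families_def bottom_powerset_algebra)
qed

text \<open>If any two points share a member of \<S>, a point of \<open>x\<close> and a point of
  \<open>y\<close> provide the witness. As the right-hand side does not mention \<S>, all such
  covers induce the same contact relation.\<close>

lemma pair_mem_meeting_families:
  assumes "x \<subseteq> A" "y \<subseteq> A"
    and "\<And>a b. a \<in> A \<Longrightarrow> b \<in> A \<Longrightarrow> \<exists>S\<in>\<S>. a \<in> S \<and> b \<in> S"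
  shows "{x, y} \<in> meeting_families A \<S> \<longleftrightarrow> x \<noteq> {} \<and> y \<noteq> {}"
proof
  assume "x \<noteq> {} \<and> y \<noteq> {}"
  then obtain a b where "a \<in> x" "b \<in> y" by blast
  moreover from this obtain S where "S \<in> \<S>" "a \<in> S" "b \<in> S"
    using assms by blast
  ultimately show "{x, y} \<in> meeting_families A \<S>"
    using assms(1,2) by (auto simp: meeting_families_def)
qed (auto simp: meeting_families_def)

theorem theorem6p4:
  shows "\<exists>(B :: nat set gorder) K\<^sub>1 K\<^sub>2.
    nontrivial_boolean_algebra B \<and> ultracontact B K\<^sub>1 \<and> ultracontact B K\<^sub>2 \<and>
    K\<^sub>1 \<noteq> K\<^sub>2 \<and> contact_rel B K\<^sub>1 = contact_rel B K\<^sub>2"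
proof -
  \<comment> \<open>Three points are the least possible here: on one or two points,
    \<open>pairs\<close> would contain \<open>A\<close> itself.\<close>
  define A :: "nat set" where "A = {0, 1, 2}"
  define pairs where "pairs = {{a, b} | a b. a \<in> A \<and> b \<in> A}"
  let ?K = "meeting_families A"
  have "A \<noteq> {}" by (simp add: A_def)
  have pairs: "\<exists>S\<in>pairs. a \<in> S \<and> b \<in> S" if "a \<in> A" "b \<in> A" for a b
    using that unfolding pairs_def by blast
  \<comment> \<open>This is the case \<open>a = b\<close>, where the pair is a singleton.\<close>
  then have "A \<subseteq> \<Union>pairs" by blast
  have "{{0}, {1}, {2}} \<in> ?K {A}"
    by (simp add: meeting_families_def A_def)
  \<comment> \<open>A set \<open>{a, b}\<close> omits one of the three points and so is disjoint
    from its singleton.\<close>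
  moreover have "{{0}, {1}, {2}} \<notin> ?K pairs"
    by (auto simp: meeting_families_def pairs_def)
  ultimately have "?K pairs \<noteq> ?K {A}" by metis
  moreover have "contact_rel (powerset_algebra A) (?K pairs)
      = contact_rel (powerset_algebra A) (?K {A})"
    using pairs
    by (auto simp: contact_rel_def pair_mem_meeting_families[where \<S> = pairs]
        pair_mem_meeting_families[where \<S> = "{A}"])
  moreover have "ultracontact (powerset_algebra A) (?K pairs)"
    "ultracontact (powerset_algebra A) (?K {A})"
    using \<open>A \<noteq> {}\<close> \<open>A \<subseteq> \<Union>pairs\<close> by (simp_all add: ultracontact_meeting_families)
  ultimately show ?thesis
    using nontrivial_boolean_algebra_powerset_algebra[OF \<open>A \<noteq> {}\<close>] by metis
qed

end
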